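(* Let $K$ be a field and let $A,B$ be finite subsets of the multiplicative group $K^{*}=K\setminus\{0\}$. Let $A\cdot B=\{ab : a\in A,\ b\in B\}$ and $A\dot\times B=\{ab : a\in A,\ b\in B,\ a\neq b\}$, and assume that $A\dot\times B\neq A\cdot B$. Let $N=\{a\in A\cap B : a^2\notin A\dot\times B\}$. Then $|A\dot\times B|\geq |A|+|B|-2-\lfloor |N|/2\rfloor$.
   Context: For finite subsets $A,B$ of a multiplicatively written abelian group, the product set is $A\cdot B=\{ab : a\in A,\ b\in B\}$ and the restricted product set is $A\dot\times B=\{ab : a\in A,\ b\in B,\ a\neq b\}$. Here $\lfloor\cdot\rfloor$ denotes the integer part. *)

theory Defs
  imports Complex_Main "HOL-Library.Set_Algebras"
begin

text \<open>The unrestricted product set is the elementwise product \<open>A * B\<close> of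
  \<^theory>\<open>HOL-Library.Set_Algebras\<close>.\<close>

definition restricted_prod :: "'a::times set \<Rightarrow> 'a set \<Rightarrow> 'a set"
  where "restricted_prod A B = {a * b | a b. a \<in> A \<and> b \<in> B \<and> a \<noteq> b}"

end

theory Submission
  imports Defs
begin

text \<open>
  The proof is a polynomial method in the plane. Write \<open>C\<close> for the restricted product set and
  send a pair \<open>(a, b)\<close> to the point \<open>(a, inverse b)\<close>. Inverting the second coordinate makes
  multiplicative conditions linear: the pairs with product \<open>c\<close> are the grid points on the line
  \<open>x = c y\<close>. The \<open>card C\<close> lines with \<open>c \<in> C\<close> therefore cover the whole grid
  \<open>A \<times> inverse ` B\<close> except the points \<open>(a, inverse a)\<close> with \<open>a \<in> N\<close>.

  These remaining points lie on the hyperbola \<open>x y = 1\<close>, which no line meets in more than two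
  points. Choose \<open>p \<in> N\<close>; it exists because the two product sets differ. Joining the points of
  \<open>N - {p}\<close> in pairs, with a tangent if one is left over, takes \<open>card N div 2\<close> lines, none of which
  passes through \<open>(p, inverse p)\<close> (\<open>lines_through_hyperbola_points\<close>).

  So \<open>card C + card N div 2\<close> lines cover all points of the grid except one. By the two-dimensional
  case of the Alon--Furedi theorem (\<open>almost_cover_grid_by_lines\<close>), such a family has at least
  \<open>card A + card B - 2\<close> members, which is the claim. That case is proved with divided differences:
  the weights from Lagrange interpolation annihilate every product of too few affine forms, whereas
  a product that is nonzero at exactly one grid point has a nonzero weighted sum.
\<close>

section \<open>Divided differences\<close>

text \<open>The coefficient of \<open>f a\<close> in the divided difference of a function \<open>f\<close> on the nodes \<open>A\<close>.\<close>

definition divdiff_weight :: "'a::field set \<Rightarrow> 'a \<Rightarrow> 'a"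
  where "divdiff_weight A a = inverse (\<Prod>c\<in>A - {a}. a - c)"

lemma divdiff_weight_nonzero: "finite A \<Longrightarrow> divdiff_weight A a \<noteq> 0"
  by (auto simp: divdiff_weight_def)

text \<open>The factor \<open>a - t\<close> cancels the node \<open>t\<close>; this is the recursion that drives the induction on
  the number of nodes.\<close>

lemma divdiff_remove_node:
  fixes A :: "'a::field set"
  assumes "finite A" "t \<in> A"
  shows "(\<Sum>a\<in>A. divdiff_weight A a * ((a - t) * f a))
       = (\<Sum>a\<in>A - {t}. divdiff_weight (A - {t}) a * f a)"
proof -
  have weight: "divdiff_weight A a * (a - t) = divdiff_weight (A - {t}) a" if "a \<in> A - {t}" for a
  proof -
    have "A - {a} = insert t (A - {t} - {a})"
      using assms that by auto
    then have "(\<Prod>c\<in>A - {a}. a - c) = (a - t) * (\<Prod>c\<in>A - {t} - {a}. a - c)"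
      using assms by simp
    then show ?thesis
      using that by (simp add: divdiff_weight_def)
  qed
  have "(\<Sum>a\<in>A. divdiff_weight A a * ((a - t) * f a))
      = (\<Sum>a\<in>A - {t}. divdiff_weight A a * ((a - t) * f a))"
    using assms by (simp add: sum.remove)
  also have "\<dots> = (\<Sum>a\<in>A - {t}. divdiff_weight (A - {t}) a * f a)"
    using weight by (intro sum.cong) (simp_all flip: mult.assoc)
  finally show ?thesis .
qed

text \<open>A divided difference annihilates polynomials of degree less than the number of nodes minus
  one. Let \<open>S i\<close> be the divided difference of \<open>x^i\<close>. Removing a node \<open>t\<close> gives
  \<open>S (i + 1) = t * S i\<close> for \<open>i + 2 < card A\<close>, by induction on the number of nodes. With at least
  three nodes this holds for \<open>i = 0\<close> and two different values of \<open>t\<close>, so \<open>S 0 = 0\<close>; with two nodes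
  \<open>S 0\<close> is computed directly. The higher moments follow one after another.\<close>

lemma divdiff_power_eq_0:
  fixes A :: "'a::field set"
  assumes "finite A" "i + 1 < card A"
  shows "(\<Sum>a\<in>A. divdiff_weight A a * a ^ i) = 0"
  using assms
proof (induction "card A" arbitrary: A i rule: less_induct)
  case less
  define S where "S i = (\<Sum>a\<in>A. divdiff_weight A a * a ^ i)" for i
  have recursion: "S (Suc k) - t * S k
      = (\<Sum>a\<in>A - {t}. divdiff_weight (A - {t}) a * a ^ k)" if "t \<in> A" for t k
    using divdiff_remove_node[OF less.prems(1) that, of "\<lambda>a. a ^ k"]
    by (simp add: S_def sum_subtractf sum_distrib_left algebra_simps)
  have step: "S (Suc k) = t * S k" if "t \<in> A" "k + 2 < card A" for t k
    using recursion[OF that(1), of k] less.hyps[of "A - {t}" k] less.prems(1) that by simp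
  have zero: "S 0 = 0"
  proof (cases "card A = 2")
    case True
    then obtain s t where "A = {s, t}" "s \<noteq> t"
      by (auto simp: card_2_iff)
    then show ?thesis
      using inverse_minus_eq[of "s - t"] by (simp add: S_def divdiff_weight_def insert_Diff_if)
  next
    case False
    then have "2 < card A"
      using less.prems by simp
    obtain s t where "s \<in> A" "t \<in> A" "s \<noteq> t"
      using \<open>2 < card A\<close> card_le_Suc0_iff_eq[OF less.prems(1)] by force
    then have "s * S 0 = t * S 0"
      using step[of _ 0] \<open>2 < card A\<close> by (metis add_0)
    then show ?thesis
      using \<open>s \<noteq> t\<close> by simp
  qed
  obtain t where "t \<in> A"
    using less.prems by fastforce
  have "S k = 0" if "k + 1 < card A" for k
    using that by (induction k) (use zero step[OF \<open>t \<in> A\<close>] in auto)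
  then show ?case
    using less.prems(2) by (simp add: S_def)
qed

section \<open>Covering all but one point of a grid by lines\<close>

definition affine_form :: "'a::field \<times> 'a \<times> 'a \<Rightarrow> 'a \<Rightarrow> 'a \<Rightarrow> 'a"
  where "affine_form l x y = (case l of (\<alpha>, \<beta>, \<gamma>) \<Rightarrow> \<alpha> * x + \<beta> * y + \<gamma>)"

text \<open>The iterated divided difference annihilates \<open>x^i y^j\<close> as soon as one of the exponents is small
  for its own set of nodes. Carrying this monomial along allows an induction on the list of affine
  forms in which one form after another is multiplied out, so that no bivariate polynomials are
  needed.\<close>

lemma divdiff_prod_affine_forms_eq_0:
  fixes A B :: "'a::field set"
  assumes "finite A" "finite B" "i + j + length ls + 2 < card A + card B"
  shows "(\<Sum>a\<in>A. \<Sum>b\<in>B. divdiff_weight A a * divdiff_weight B b * (a ^ i * b ^ j)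
           * (\<Prod>l\<leftarrow>ls. affine_form l a b)) = 0"
  using assms(3)
proof (induction ls arbitrary: i j)
  case Nil
  have "(\<Sum>a\<in>A. divdiff_weight A a * a ^ i) * (\<Sum>b\<in>B. divdiff_weight B b * b ^ j) = 0"
    using divdiff_power_eq_0[OF assms(1), of i] divdiff_power_eq_0[OF assms(2), of j] Nil
    by force
  then show ?case
    by (simp add: sum_product mult_ac)
next
  case (Cons l ls)
  obtain \<alpha> \<beta> \<gamma> where l: "l = (\<alpha>, \<beta>, \<gamma>)"
    by (cases l)
  define F where "F i j = (\<Sum>a\<in>A. \<Sum>b\<in>B. divdiff_weight A a * divdiff_weight B b * (a ^ i * b ^ j)
           * (\<Prod>l\<leftarrow>ls. affine_form l a b))" for i j
  have "(\<Sum>a\<in>A. \<Sum>b\<in>B. divdiff_weight A a * divdiff_weight B b * (a ^ i * b ^ j)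
           * (\<Prod>l\<leftarrow>l # ls. affine_form l a b)) = \<alpha> * F (Suc i) j + \<beta> * F i (Suc j) + \<gamma> * F i j"
    by (simp add: F_def l affine_form_def sum_distrib_left sum.distrib algebra_simps)
  moreover have "F (Suc i) j = 0" "F i (Suc j) = 0" "F i j = 0"
    unfolding F_def by (rule Cons.IH; use Cons.prems in simp)+
  ultimately show ?case
    by simp
qed

text \<open>The product of the forms is nonzero at exactly one point of the grid, and so is its weighted
  sum; by the previous lemma there cannot be too few forms.\<close>

lemma almost_cover_grid_by_lines:
  fixes A B :: "'a::field set"
  assumes fin: "finite A" "finite B"
    and uncovered: "p \<in> A" "q \<in> B" "\<forall>l\<in>set ls. affine_form l p q \<noteq> 0"
    and covered: "\<And>a b. a \<in> A \<Longrightarrow> b \<in> B \<Longrightarrow> (a, b) \<noteq> (p, q) \<Longrightarrow> \<exists>l\<in>set ls. affine_form l a b = 0"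
  shows "card A + card B \<le> length ls + 2"
proof (rule ccontr)
  assume few: "\<not> ?thesis"
  define f where "f = (\<lambda>(a, b). divdiff_weight A a * divdiff_weight B b * (\<Prod>l\<leftarrow>ls. affine_form l a b))"
  have "f z = 0" if "z \<in> A \<times> B - {(p, q)}" for z
    using that covered by (fastforce simp: f_def prod_list_zero_iff)
  then have "f (p, q) = sum f (A \<times> B)"
    using fin uncovered by (simp add: sum.remove[of "A \<times> B" "(p, q)"])
  also have "\<dots> = 0"
    using divdiff_prod_affine_forms_eq_0[OF fin, of 0 0 ls] few
    by (simp add: f_def sum.cartesian_product)
  finally show False
    using fin uncovered by (auto simp: f_def prod_list_zero_iff divdiff_weight_nonzero)
qed

section \<open>Lines meeting the hyperbola\<close>

text \<open>The line through the points of the hyperbola \<open>x y = 1\<close> with abscissas \<open>s\<close> and \<open>t\<close>, which is the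
  tangent if \<open>s = t\<close>.\<close>

definition hyperbola_secant :: "'a::field \<Rightarrow> 'a \<Rightarrow> 'a \<times> 'a \<times> 'a"
  where "hyperbola_secant s t = (1, s * t, - (s + t))"

lemma hyperbola_secant_eq_0_iff:
  assumes "z \<noteq> 0"
  shows "affine_form (hyperbola_secant s t) z (inverse z) = 0 \<longleftrightarrow> z = s \<or> z = t"
proof -
  have "affine_form (hyperbola_secant s t) z (inverse z) = (z - s) * (z - t) / z"
    using assms by (simp add: affine_form_def hyperbola_secant_def field_simps)
  then show ?thesis
    using assms by simp
qed

text \<open>A secant takes care of two points at a time and meets the hyperbola nowhere else, so that
  \<open>p\<close> stays uncovered.\<close>

lemma lines_through_hyperbola_points:
  fixes M :: "'a::field set"
  assumes "finite M" "0 \<notin> M" "p \<notin> M" "p \<noteq> 0"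
  shows "\<exists>ls. length ls \<le> (card M + 1) div 2 \<and>
    (\<forall>a\<in>M. \<exists>l\<in>set ls. affine_form l a (inverse a) = 0) \<and>
    (\<forall>l\<in>set ls. affine_form l p (inverse p) \<noteq> 0)"
  using assms
proof (induction "card M" arbitrary: M rule: less_induct)
  case less
  show ?case
  proof (cases "M = {}")
    case True
    then show ?thesis
      by (intro exI[of _ "[]"]) simp
  next
    case False
    then obtain s where s: "s \<in> M"
      by blast
    \<comment> \<open>If \<open>s\<close> is the only point, the tangent at \<open>s\<close> is used.\<close>
    obtain t where t: "t \<in> M" "M = {s} \<or> t \<noteq> s"
      using s by blast
    define M' where "M' = M - {s, t}"
    have "M' \<subset> M"
      using s by (auto simp: M'_def)
    then have smaller: "card M' < card M"
      using less.prems(1) by (rule psubset_card_mono[rotated])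
    have size: "(card M' + 1) div 2 + 1 \<le> (card M + 1) div 2"
    proof (cases "t = s")
      case True
      then show ?thesis
        using s t by (auto simp: M'_def)
    next
      case False
      then have "card M = card M' + 2"
        using card_Diff_subset[of "{s, t}" M] card_mono[of M "{s, t}"] s t less.prems(1)
        by (simp add: M'_def)
      then show ?thesis
        by simp
    qed
    obtain ls where ls: "length ls \<le> (card M' + 1) div 2"
      "\<forall>a\<in>M'. \<exists>l\<in>set ls. affine_form l a (inverse a) = 0"
      "\<forall>l\<in>set ls. affine_form l p (inverse p) \<noteq> 0"
      using less.hyps[OF smaller] less.prems by (auto simp: M'_def)
    have "\<exists>l\<in>set (hyperbola_secant s t # ls). affine_form l a (inverse a) = 0" if "a \<in> M" for a
    proof (cases "a \<in> M'")
      case True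
      then show ?thesis
        using ls(2) by auto
    next
      case False
      moreover have "a \<noteq> 0"
        using that less.prems(2) by auto
      ultimately show ?thesis
        using that hyperbola_secant_eq_0_iff[of a s t] by (auto simp: M'_def)
    qed
    moreover have "affine_form (hyperbola_secant s t) p (inverse p) \<noteq> 0"
      using hyperbola_secant_eq_0_iff[of p s t] s t less.prems by auto
    ultimately show ?thesis
      using ls size by (intro exI[of _ "hyperbola_secant s t # ls"]) auto
  qed
qed

section \<open>The restricted product set\<close>

theorem theorem8:
  fixes A B N :: "'a::field set"
  assumes "finite A" and "finite B"
    and "A \<subseteq> UNIV - {0}" and "B \<subseteq> UNIV - {0}"
    and "restricted_prod A B \<noteq> A * B"
    and "N = {a \<in> A \<inter> B. a\<^sup>2 \<notin> restricted_prod A B}"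
  shows "int (card (restricted_prod A B)) \<ge> int (card A) + int (card B) - 2 - \<lfloor>real (card N) / 2\<rfloor>"
proof -
  define C where "C = restricted_prod A B"
  have diagonal: "a = b \<and> a \<in> N" if "a \<in> A" "b \<in> B" "a * b \<notin> C" for a b
    using that assms(6) by (auto simp: C_def restricted_prod_def power2_eq_square)
  have "C \<subseteq> A * B"
    by (auto simp: C_def restricted_prod_def set_times_def)
  then obtain a b where "a \<in> A" "b \<in> B" "a * b \<notin> C"
    using assms(5) by (auto simp: C_def set_times_def)
  then obtain p where p: "p \<in> N"
    using diagonal by blast
  have "finite (A * B)"
    using assms(1,2) by (rule finite_set_times)
  then have "finite C"
    using \<open>C \<subseteq> A * B\<close> finite_subset by blast
  then obtain cs where cs: "set cs = C" "distinct cs"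
    using finite_distinct_list by blast
  have N: "finite N" "N \<subseteq> A \<inter> B"
    using assms(1,6) by auto
  have "p \<noteq> 0"
    using p N assms(3) by auto
  obtain ls where ls: "length ls \<le> (card (N - {p}) + 1) div 2"
    "\<forall>a\<in>N - {p}. \<exists>l\<in>set ls. affine_form l a (inverse a) = 0"
    "\<forall>l\<in>set ls. affine_form l p (inverse p) \<noteq> 0"
    using lines_through_hyperbola_points[of "N - {p}" p] N assms(3) \<open>p \<noteq> 0\<close> by auto
  have "card (N - {p}) + 1 = card N"
    using p N card_Suc_Diff1 by fastforce
  define lines where "lines = map (\<lambda>c. (1, - c, 0)) cs @ ls"
  have "card A + card (inverse ` B) \<le> length lines + 2"
  proof (rule almost_cover_grid_by_lines)
    show "finite A" "finite (inverse ` B)" "p \<in> A" "inverse p \<in> inverse ` B"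
      using assms(1,2) p N by auto
    have "p - c * inverse p \<noteq> 0" if "c \<in> C" for c
    proof
      assume "p - c * inverse p = 0"
      then have "p\<^sup>2 = c"
        using \<open>p \<noteq> 0\<close> by (simp add: field_simps power2_eq_square)
      then show False
        using that p assms(6) by (simp add: C_def)
    qed
    then show "\<forall>l\<in>set lines. affine_form l p (inverse p) \<noteq> 0"
      using ls(3) cs by (auto simp: lines_def affine_form_def)
  next
    fix a y
    assume a: "a \<in> A" and "y \<in> inverse ` B" and other: "(a, y) \<noteq> (p, inverse p)"
    then obtain b where b: "b \<in> B" "y = inverse b"
      by blast
    then have "b \<noteq> 0"
      using assms(4) by auto
    show "\<exists>l\<in>set lines. affine_form l a y = 0"
    proof (cases "a * b \<in> C")
      case True
      then have "(1, - (a * b), 0) \<in> set lines"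
        using cs by (auto simp: lines_def)
      moreover have "affine_form (1, - (a * b), 0) a y = 0"
        using b \<open>b \<noteq> 0\<close> by (simp add: affine_form_def)
      ultimately show ?thesis
        by blast
    next
      case False
      then have "a = b" "a \<in> N - {p}"
        using diagonal a b other by auto
      then show ?thesis
        using ls(2) b by (auto simp: lines_def)
    qed
  qed
  moreover have "card (inverse ` B) = card B"
    by (intro card_image) (simp add: inj_on_def)
  moreover have "length lines \<le> card C + card N div 2"
    using ls(1) cs \<open>card (N - {p}) + 1 = card N\<close> distinct_card[OF cs(2)] by (simp add: lines_def)
  moreover have "\<lfloor>real (card N) / 2\<rfloor> = int (card N div 2)"
    using floor_divide_of_nat_eq[of "card N" 2] by simp
  ultimately show ?thesis
    unfolding C_def by linarith
qed

end
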